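(* Let $G=(V,E,w)$ be a weighted graph on $n$ vertices and let $N$ be either the adjacency matrix $A(G)$ or the signless Laplacian matrix $Q(G)$ of $G$. Then $$mcut(G)\leq \frac{n}{4}\,s_N(G),$$ where $s_N(G)$ denotes the difference between the largest and the smallest eigenvalue of $N$.
   Context: A weighted graph $G=(V,E,w)$ is a finite simple graph with a weight $w_{ij}=w_{ji}>0$ on each edge $v_iv_j\in E$ (an unweighted graph has all weights $1$). Its adjacency matrix $A(G)$ has $(i,j)$ entry $w_{ij}$ if $v_iv_j\in E$ and $0$ otherwise; $D(G)$ is the diagonal matrix of row sums of $A(G)$, and $Q(G)=D(G)+A(G)$. For $X\subseteq V$ and $\overline{X}=V\setminus X$, $cut_G(X)$ is the sum of the weights of the edges with one endpoint in $X$ and the other in $\overline{X}$, and $mcut(G)=\max_{X\subseteq V}cut_G(X)$. *)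

theory Defs
  imports "Jordan_Normal_Form.Spectral_Radius"
begin

text \<open>
  Edges are two-element sets of vertices and weights are attached to edges, so the symmetry
  $w_{ij} = w_{ji}$ is built in: $w_{ij}$ is \<open>w {v i, v j}\<close>. Values of \<open>w\<close> outside \<open>E\<close> are irrelevant.
\<close>

locale weighted_graph =
  fixes V :: "'a set" and E :: "'a set set" and w :: "'a set \<Rightarrow> real"
  assumes finite_V: "finite V"
    and simple_edges: "\<And>e. e \<in> E \<Longrightarrow> e \<subseteq> V \<and> card e = 2"
    and weight_pos: "\<And>e. e \<in> E \<Longrightarrow> w e > 0"

definition cut :: "'a set \<Rightarrow> 'a set set \<Rightarrow> ('a set \<Rightarrow> real) \<Rightarrow> 'a set \<Rightarrow> real" where
  "cut V E w X = (\<Sum>e | e \<in> E \<and> (\<exists>x \<in> X. \<exists>y \<in> V - X. e = {x, y}). w e)"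

definition mcut :: "'a set \<Rightarrow> 'a set set \<Rightarrow> ('a set \<Rightarrow> real) \<Rightarrow> real" where
  "mcut V E w = Max (cut V E w ` Pow V)"

text \<open>
  The matrices depend on an enumeration \<open>v 0, \<dots>, v (n - 1)\<close> of the vertices; indices start
  at 0 as for all matrices of type \<open>mat\<close>.
\<close>

definition adjacency_matrix ::
    "nat \<Rightarrow> (nat \<Rightarrow> 'a) \<Rightarrow> 'a set set \<Rightarrow> ('a set \<Rightarrow> real) \<Rightarrow> real mat" where
  "adjacency_matrix n v E w =
     mat n n (\<lambda>(i, j). if {v i, v j} \<in> E then w {v i, v j} else 0)"

definition degree_matrix ::
    "nat \<Rightarrow> (nat \<Rightarrow> 'a) \<Rightarrow> 'a set set \<Rightarrow> ('a set \<Rightarrow> real) \<Rightarrow> real mat" where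
  "degree_matrix n v E w =
     mat n n (\<lambda>(i, j). if i = j then (\<Sum>k<n. adjacency_matrix n v E w $$ (i, k)) else 0)"

definition signless_laplacian ::
    "nat \<Rightarrow> (nat \<Rightarrow> 'a) \<Rightarrow> 'a set set \<Rightarrow> ('a set \<Rightarrow> real) \<Rightarrow> real mat" where
  "signless_laplacian n v E w = degree_matrix n v E w + adjacency_matrix n v E w"

text \<open>
  Only used for real symmetric matrices of positive dimension: all their complex eigenvalues
  are real and there is at least one, so \<open>Max\<close> and \<open>Min\<close> are taken over a finite nonempty set.
\<close>

definition eigenvalue_spread :: "real mat \<Rightarrow> real" where
  "eigenvalue_spread N = Max (spectrum N) - Min (spectrum N)"

end

theory Submission
  imports Defs
begin

text \<open>
  For \<open>X \<subseteq> V\<close> let \<open>x\<close> be the vector with entry \<open>1\<close> on \<open>X\<close> and \<open>-1\<close> off \<open>X\<close>, and let \<open>\<one>\<close> be the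
  all-ones vector. In \<open>\<one>\<^sup>T N \<one> - x\<^sup>T N x = (\<Sum>i,j. N\<^sub>i\<^sub>j (1 - x\<^sub>i x\<^sub>j))\<close> the diagonal of \<open>N\<close> cancels
  because \<open>x\<^sub>i\<^sup>2 = 1\<close>, which is why the adjacency matrix and the signless Laplacian can be treated
  alike. Each edge crossing the cut occurs in two ordered pairs with factor \<open>2\<close>, and every other
  pair contributes nothing, so the difference is \<open>4 cut(X)\<close> (\<open>cut_eq_form_diff\<close>). Both vectors have
  squared length \<open>n\<close>; by Rayleigh's principle the two forms are at most \<open>n \<lambda>\<^sub>m\<^sub>a\<^sub>x\<close> and at least
  \<open>n \<lambda>\<^sub>m\<^sub>i\<^sub>n\<close> (\<open>form_diff_le_spread\<close>), and dividing by four gives the bound for every \<open>X\<close>.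

  Rayleigh's principle for a real symmetric matrix \<open>A\<close> is obtained algebraically, without compactness
  of the sphere. If \<open>\<lambda>\<close> is the supremum of the Rayleigh quotient, then \<open>\<lambda> I - A\<close> is positive
  semidefinite. Were it invertible, it would be bounded below by a positive multiple of the identity
  (\<open>psd_nonsingular_coercive\<close>), so that \<open>\<lambda>\<close> could be lowered. Hence \<open>\<lambda>\<close> is an eigenvalue
  (\<open>symmetric_form_le_eigenvalue\<close>). Applied to \<open>-A\<close>, this gives the lower bound.
\<close>

section \<open>Rayleigh's principle for real symmetric matrices\<close>

lemma quadratic_form_sum:
  fixes A :: "real mat"
  assumes "A \<in> carrier_mat n n" and "x \<in> carrier_vec n"
  shows "x \<bullet> (A *\<^sub>v x) = (\<Sum>i<n. \<Sum>j<n. A $$ (i, j) * (x $ i * x $ j))"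
  using assms
  by (auto simp: scalar_prod_def sum_distrib_left lessThan_atLeast0 algebra_simps intro!: sum.cong)

lemma scalar_prod_self_sum:
  fixes x :: "real vec"
  assumes "x \<in> carrier_vec n"
  shows "x \<bullet> x = (\<Sum>i<n. (x $ i)\<^sup>2)"
  using assms by (auto simp: scalar_prod_def lessThan_atLeast0 power2_eq_square)

lemma scalar_prod_self_pos:
  fixes x :: "real vec"
  assumes "x \<in> carrier_vec n" and "x \<noteq> 0\<^sub>v n"
  shows "x \<bullet> x > 0"
  using conjugate_square_greater_0_vec[OF assms(1)] assms(2) by simp

lemma symmetric_scalar_prod_swap:
  fixes A :: "real mat"
  assumes A: "A \<in> carrier_mat n n" and sym: "transpose_mat A = A"
    and x: "x \<in> carrier_vec n" and y: "y \<in> carrier_vec n"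
  shows "x \<bullet> (A *\<^sub>v y) = y \<bullet> (A *\<^sub>v x)"
proof -
  have "(A *\<^sub>v x) \<bullet> y = x \<bullet> (A *\<^sub>v y)"
    using transpose_vec_mult_scalar[OF A y x] sym by simp
  moreover have "(A *\<^sub>v x) \<bullet> y = y \<bullet> (A *\<^sub>v x)"
    using A x y by (intro comm_scalar_prod[of _ n]) auto
  ultimately show ?thesis by simp
qed

lemma quadratic_form_bounded:
  fixes A :: "real mat"
  assumes A: "A \<in> carrier_mat n n"
  obtains M where "M > 0" and "\<And>x. x \<in> carrier_vec n \<Longrightarrow> x \<bullet> (A *\<^sub>v x) \<le> M * (x \<bullet> x)"
proof
  \<comment> \<open>The summand \<open>1\<close> only makes the constant positive.\<close>
  define M where "M = 1 + (\<Sum>i<n. \<Sum>j<n. \<bar>A $$ (i, j)\<bar>)"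
  show "M > 0"
    unfolding M_def by (intro add_pos_nonneg sum_nonneg) auto
  fix x :: "real vec" assume x: "x \<in> carrier_vec n"
  have sq: "(x $ i)\<^sup>2 \<le> x \<bullet> x" if "i < n" for i
    unfolding scalar_prod_self_sum[OF x] using that by (intro member_le_sum) auto
  have entry: "A $$ (i, j) * (x $ i * x $ j) \<le> \<bar>A $$ (i, j)\<bar> * (x \<bullet> x)" if "i < n" "j < n" for i j
  proof -
    have "2 * \<bar>x $ i * x $ j\<bar> \<le> (x $ i)\<^sup>2 + (x $ j)\<^sup>2"
      using sum_squares_bound[of "\<bar>x $ i\<bar>" "\<bar>x $ j\<bar>"] by (simp add: abs_mult)
    then have "\<bar>x $ i * x $ j\<bar> \<le> x \<bullet> x" using sq[OF that(1)] sq[OF that(2)] by linarith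
    then have "\<bar>A $$ (i, j)\<bar> * \<bar>x $ i * x $ j\<bar> \<le> \<bar>A $$ (i, j)\<bar> * (x \<bullet> x)"
      by (intro mult_left_mono) auto
    then show ?thesis
      using abs_ge_self[of "A $$ (i, j) * (x $ i * x $ j)"] unfolding abs_mult by linarith
  qed
  have "x \<bullet> (A *\<^sub>v x) \<le> (\<Sum>i<n. \<Sum>j<n. \<bar>A $$ (i, j)\<bar> * (x \<bullet> x))"
    unfolding quadratic_form_sum[OF A x] by (intro sum_mono entry) auto
  also have "\<dots> = (M - 1) * (x \<bullet> x)"
    by (simp add: M_def sum_distrib_right)
  also have "\<dots> \<le> M * (x \<bullet> x)"
    by (intro mult_right_mono) (auto simp: scalar_prod_self_sum[OF x] sum_nonneg)
  finally show "x \<bullet> (A *\<^sub>v x) \<le> M * (x \<bullet> x)" .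
qed

text \<open>
  For a positive semidefinite form \<open>B\<close> bounded by \<open>M\<close>, the inequality
  \<open>(x - t B x)\<^sup>T B (x - t B x) \<ge> 0\<close> at \<open>t = 1/M\<close> gives \<open>|B x|\<^sup>2 \<le> M x\<^sup>T B x\<close>. When \<open>B\<close> is invertible, \<open>|x|\<^sup>2\<close> is in turn bounded by a multiple
  of \<open>|B x|\<^sup>2\<close>.
\<close>

lemma psd_nonsingular_coercive:
  fixes B :: "real mat"
  assumes B: "B \<in> carrier_mat n n" and sym: "transpose_mat B = B"
    and psd: "\<And>x. x \<in> carrier_vec n \<Longrightarrow> 0 \<le> x \<bullet> (B *\<^sub>v x)"
    and det: "det B \<noteq> 0"
  obtains c where "c > 0" and "\<And>x. x \<in> carrier_vec n \<Longrightarrow> c * (x \<bullet> x) \<le> x \<bullet> (B *\<^sub>v x)"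
proof -
  obtain C where C: "C \<in> carrier_mat n n" and CB: "C * B = 1\<^sub>m n"
    using det_non_zero_imp_unit[OF B det, of "()"] by (auto simp: Units_def ring_mat_simps)
  obtain M where M: "M > 0" and MB: "\<And>x. x \<in> carrier_vec n \<Longrightarrow> x \<bullet> (B *\<^sub>v x) \<le> M * (x \<bullet> x)"
    using quadratic_form_bounded[OF B] by blast
  have CTC: "transpose_mat C * C \<in> carrier_mat n n" using C by auto
  obtain K where K: "K > 0"
    and KC: "\<And>x. x \<in> carrier_vec n \<Longrightarrow> x \<bullet> ((transpose_mat C * C) *\<^sub>v x) \<le> K * (x \<bullet> x)"
    using quadratic_form_bounded[OF CTC] by blast
  have "1 / (K * M) * (x \<bullet> x) \<le> x \<bullet> (B *\<^sub>v x)" if x: "x \<in> carrier_vec n" for x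
  proof -
    define y where "y = B *\<^sub>v x"
    have y: "y \<in> carrier_vec n" using B x by (auto simp: y_def)
    have By: "B *\<^sub>v y \<in> carrier_vec n" using B y by auto
    define t where "t = 1 / M"
    have Bz: "B *\<^sub>v (x - t \<cdot>\<^sub>v y) = y - t \<cdot>\<^sub>v (B *\<^sub>v y)"
      using B x y by (simp add: mult_minus_distrib_mat_vec[of _ n n] mult_mat_vec y_def)
    have xBy: "x \<bullet> (B *\<^sub>v y) = y \<bullet> y"
      using symmetric_scalar_prod_swap[OF B sym x y] by (simp add: y_def)
    have "0 \<le> (x - t \<cdot>\<^sub>v y) \<bullet> (B *\<^sub>v (x - t \<cdot>\<^sub>v y))"
      using x y by (intro psd) auto
    also have "\<dots> = x \<bullet> y - 2 * t * (y \<bullet> y) + t\<^sup>2 * (y \<bullet> (B *\<^sub>v y))"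
      unfolding Bz using x y By
      by (simp add: minus_scalar_prod_distrib[of _ n] scalar_prod_minus_distrib[of _ n]
          xBy power2_eq_square algebra_simps)
    also have "\<dots> \<le> x \<bullet> y - 2 * t * (y \<bullet> y) + t\<^sup>2 * (M * (y \<bullet> y))"
      using MB[OF y] by (intro add_left_mono mult_left_mono) auto
    also have "\<dots> = x \<bullet> y - (y \<bullet> y) / M"
      using M by (simp add: t_def field_simps power2_eq_square)
    finally have yy: "(y \<bullet> y) / M \<le> x \<bullet> y" by simp
    have Cy: "C *\<^sub>v y = x"
      using assoc_mult_mat_vec[OF C B x] CB x by (simp add: y_def)
    have "x \<bullet> x = y \<bullet> ((transpose_mat C * C) *\<^sub>v y)"
    proof -
      have "y \<bullet> ((transpose_mat C * C) *\<^sub>v y) = y \<bullet> (transpose_mat C *\<^sub>v x)"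
        using assoc_mult_mat_vec[of "transpose_mat C" n n C n y] C y Cy by simp
      also have "\<dots> = (transpose_mat C *\<^sub>v x) \<bullet> y"
        using C x y by (intro comm_scalar_prod[of _ n]) auto
      also have "\<dots> = x \<bullet> x"
        using transpose_vec_mult_scalar[OF C y x] Cy by simp
      finally show ?thesis by simp
    qed
    also have "\<dots> \<le> K * (y \<bullet> y)" by (rule KC[OF y])
    finally have "(x \<bullet> x) / K \<le> y \<bullet> y" using K by (simp add: field_simps)
    then have "(x \<bullet> x) / K / M \<le> (y \<bullet> y) / M" using M by (intro divide_right_mono) auto
    with yy show ?thesis by (simp add: y_def)
  qed
  moreover have "1 / (K * M) > 0" using K M by simp
  ultimately show ?thesis using that by blast
qed

lemma symmetric_form_le_eigenvalue:
  fixes A :: "real mat"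
  assumes A: "A \<in> carrier_mat n n" and sym: "transpose_mat A = A" and n: "n > 0"
  obtains l where "eigenvalue A l" and "\<And>x. x \<in> carrier_vec n \<Longrightarrow> x \<bullet> (A *\<^sub>v x) \<le> l * (x \<bullet> x)"
proof -
  define S where "S = {x \<bullet> (A *\<^sub>v x) / (x \<bullet> x) | x. x \<in> carrier_vec n \<and> x \<noteq> 0\<^sub>v n}"
  define l where "l = Sup S"
  have "unit_vec n 0 \<in> carrier_vec n" "unit_vec n 0 \<noteq> (0\<^sub>v n :: real vec)"
    using n by (auto simp: vec_eq_iff)
  then have S_ne: "S \<noteq> {}" unfolding S_def by blast
  obtain M where "\<And>x. x \<in> carrier_vec n \<Longrightarrow> x \<bullet> (A *\<^sub>v x) \<le> M * (x \<bullet> x)"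
    using quadratic_form_bounded[OF A] by blast
  then have "bdd_above S"
    unfolding S_def using scalar_prod_self_pos
    by (intro bdd_aboveI[of _ M]) (auto simp: divide_le_eq)
  then have le: "x \<bullet> (A *\<^sub>v x) \<le> l * (x \<bullet> x)" if "x \<in> carrier_vec n" for x
  proof (cases "x = 0\<^sub>v n")
    case True
    then show ?thesis using A by simp
  next
    case False
    then have "x \<bullet> (A *\<^sub>v x) / (x \<bullet> x) \<le> l"
      unfolding l_def using that \<open>bdd_above S\<close> by (intro cSup_upper) (auto simp: S_def)
    then show ?thesis using scalar_prod_self_pos[OF that False] by (simp add: divide_le_eq)
  qed
  define B where "B = l \<cdot>\<^sub>m 1\<^sub>m n - A"
  have B: "B \<in> carrier_mat n n" using A by (auto simp: B_def)
  have A_sym: "A $$ (j, i) = A $$ (i, j)" if "i < n" "j < n" for i j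
    using that A sym by (metis carrier_matD index_transpose_mat(1))
  have B_sym: "transpose_mat B = B"
    using A by (intro eq_matI) (auto simp: B_def A_sym)
  have B_vec: "B *\<^sub>v x = l \<cdot>\<^sub>v x - A *\<^sub>v x" if "x \<in> carrier_vec n" for x
  proof -
    have "(l \<cdot>\<^sub>m 1\<^sub>m n) *\<^sub>v x = l \<cdot>\<^sub>v x"
      using that by (intro eq_vecI) auto
    then show ?thesis using A that by (simp add: B_def minus_mult_distrib_mat_vec[of _ n n])
  qed
  have B_form: "x \<bullet> (B *\<^sub>v x) = l * (x \<bullet> x) - x \<bullet> (A *\<^sub>v x)" if "x \<in> carrier_vec n" for x
    using A that by (simp add: B_vec scalar_prod_minus_distrib[of _ n])
  have "det B = 0"
  proof (rule ccontr)
    assume "det B \<noteq> 0"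
    then obtain c where c: "c > 0" "\<And>x. x \<in> carrier_vec n \<Longrightarrow> c * (x \<bullet> x) \<le> x \<bullet> (B *\<^sub>v x)"
      using psd_nonsingular_coercive[OF B B_sym] le B_form by (metis diff_ge_0_iff_ge)
    have "s \<le> l - c" if "s \<in> S" for s
    proof -
      from that obtain x where x: "x \<in> carrier_vec n" "x \<noteq> 0\<^sub>v n"
        and s: "s = x \<bullet> (A *\<^sub>v x) / (x \<bullet> x)" unfolding S_def by blast
      have "x \<bullet> (A *\<^sub>v x) \<le> (l - c) * (x \<bullet> x)"
        using c(2)[OF x(1)] B_form[OF x(1)] by (simp add: algebra_simps)
      then show ?thesis using scalar_prod_self_pos[OF x] by (simp add: s divide_le_eq)
    qed
    then have "l \<le> l - c" unfolding l_def using S_ne by (intro cSup_least)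
    with c(1) show False by simp
  qed
  then obtain x where x: "x \<in> carrier_vec n" "x \<noteq> 0\<^sub>v n" "B *\<^sub>v x = 0\<^sub>v n"
    using det_0_iff_vec_prod_zero_field[OF B] by blast
  have "A *\<^sub>v x = l \<cdot>\<^sub>v x"
  proof (intro eq_vecI)
    fix i assume i: "i < dim_vec (l \<cdot>\<^sub>v x)"
    then have "(l \<cdot>\<^sub>v x - A *\<^sub>v x) $ i = 0" using x B_vec[OF x(1)] by auto
    then show "(A *\<^sub>v x) $ i = (l \<cdot>\<^sub>v x) $ i" using i x(1) A by auto
  qed (use A x in auto)
  then have "eigenvalue A l"
    using A x unfolding eigenvalue_def eigenvector_def by auto
  with le show ?thesis using that by blast
qed

lemma form_diff_le_spread:
  fixes A :: "real mat"
  assumes A: "A \<in> carrier_mat n n" and sym: "transpose_mat A = A" and n: "n > 0"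
    and x: "x \<in> carrier_vec n" and y: "y \<in> carrier_vec n" and xy: "y \<bullet> y = x \<bullet> x"
  shows "y \<bullet> (A *\<^sub>v y) - x \<bullet> (A *\<^sub>v x) \<le> eigenvalue_spread A * (x \<bullet> x)"
proof -
  have fin: "finite (spectrum A)" by (rule card_finite_spectrum[OF A])
  have nonneg: "x \<bullet> x \<ge> 0" by (simp add: scalar_prod_self_sum[OF x] sum_nonneg)
  obtain l where l: "eigenvalue A l" and upper: "y \<bullet> (A *\<^sub>v y) \<le> l * (x \<bullet> x)"
    using symmetric_form_le_eigenvalue[OF A sym n] y xy by metis
  have A': "- A \<in> carrier_mat n n" using A by simp
  have sym': "transpose_mat (- A) = - A" using sym transpose_uminus[of A] by simp
  have uminus_vec: "(- A) *\<^sub>v z = - (A *\<^sub>v z)" if "z \<in> carrier_vec n" for z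
    using A that by (intro eq_vecI) auto
  obtain m where m: "eigenvalue (- A) m" and lower: "x \<bullet> ((- A) *\<^sub>v x) \<le> m * (x \<bullet> x)"
    using symmetric_form_le_eigenvalue[OF A' sym' n] x by metis
  from m obtain z where z: "z \<in> carrier_vec n" "z \<noteq> 0\<^sub>v n" "(- A) *\<^sub>v z = m \<cdot>\<^sub>v z"
    using A unfolding eigenvalue_def eigenvector_def by auto
  have "A *\<^sub>v z = - ((- A) *\<^sub>v z)" using A z(1) by (simp add: uminus_vec)
  also have "\<dots> = (- m) \<cdot>\<^sub>v z" unfolding z(3) by (intro eq_vecI) auto
  finally have "eigenvalue A (- m)"
    using A z unfolding eigenvalue_def eigenvector_def by auto
  then have "Min (spectrum A) \<le> - m" using fin by (intro Min_le) (auto simp: spectrum_def)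
  moreover have "l \<le> Max (spectrum A)" using fin l by (intro Max_ge) (auto simp: spectrum_def)
  ultimately have "l + m \<le> eigenvalue_spread A" by (simp add: eigenvalue_spread_def)
  then have "(l + m) * (x \<bullet> x) \<le> eigenvalue_spread A * (x \<bullet> x)"
    using nonneg by (rule mult_right_mono)
  moreover have "- (x \<bullet> (A *\<^sub>v x)) \<le> m * (x \<bullet> x)"
    using lower A x by (simp add: uminus_vec)
  ultimately show ?thesis using upper by (simp add: algebra_simps)
qed

section \<open>Cuts as differences of quadratic forms\<close>

definition cut_vector :: "nat \<Rightarrow> (nat \<Rightarrow> 'a) \<Rightarrow> 'a set \<Rightarrow> real vec" where
  "cut_vector n v X = vec n (\<lambda>i. if v i \<in> X then 1 else - 1)"

lemma cut_vector_closed [simp]: "cut_vector n v X \<in> carrier_vec n"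
  by (simp add: cut_vector_def)

lemma cut_vector_norm: "cut_vector n v X \<bullet> cut_vector n v X = real n"
proof -
  have "(\<Sum>i<n. (cut_vector n v X $ i)\<^sup>2) = (\<Sum>i<n. 1)"
    by (intro sum.cong) (auto simp: cut_vector_def)
  then show ?thesis by (simp add: scalar_prod_self_sum[OF cut_vector_closed])
qed

text \<open>
  Orienting every crossing edge from its endpoint in \<open>X\<close> to the one outside turns the sum over
  edges into a sum over ordered index pairs.
\<close>

lemma cut_eq_pair_sum:
  assumes bij: "bij_betw v {..<n} V" and X: "X \<subseteq> V"
  shows "cut V E w X =
    (\<Sum>i<n. \<Sum>j<n. if v i \<in> X \<and> v j \<notin> X then adjacency_matrix n v E w $$ (i, j) else 0)"
proof -
  define P where "P = {(i, j). i < n \<and> j < n \<and> v i \<in> X \<and> v j \<notin> X \<and> {v i, v j} \<in> E}"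
  have inj: "inj_on v {..<n}" and V: "V = v ` {..<n}"
    using bij by (auto simp: bij_betw_def)
  have "bij_betw (\<lambda>(i, j). {v i, v j}) P {e. e \<in> E \<and> (\<exists>x \<in> X. \<exists>y \<in> V - X. e = {x, y})}"
  proof (rule bij_betwI')
    fix p q assume "p \<in> P" "q \<in> P"
    then show "((case p of (i, j) \<Rightarrow> {v i, v j}) = (case q of (i, j) \<Rightarrow> {v i, v j})) = (p = q)"
      using inj by (auto simp: P_def doubleton_eq_iff inj_on_def)
  next
    fix p assume "p \<in> P"
    then show "(case p of (i, j) \<Rightarrow> {v i, v j}) \<in> {e. e \<in> E \<and> (\<exists>x \<in> X. \<exists>y \<in> V - X. e = {x, y})}"
      by (auto simp: P_def V)
  next
    fix e assume "e \<in> {e. e \<in> E \<and> (\<exists>x \<in> X. \<exists>y \<in> V - X. e = {x, y})}"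
    then obtain x y where e: "e \<in> E" "e = {x, y}" "x \<in> X" "y \<in> V" "y \<notin> X" by blast
    then obtain i j where "i < n" "x = v i" "j < n" "y = v j" using X V by blast
    with e show "\<exists>p\<in>P. e = (case p of (i, j) \<Rightarrow> {v i, v j})"
      by (intro bexI[of _ "(i, j)"]) (auto simp: P_def)
  qed
  then have "cut V E w X = (\<Sum>(i, j)\<in>P. w {v i, v j})"
    unfolding cut_def by (subst sum.reindex_bij_betw[symmetric]) (auto simp: case_prod_unfold)
  also have "\<dots> = (\<Sum>(i, j)\<in>{..<n} \<times> {..<n}.
      if v i \<in> X \<and> v j \<notin> X then adjacency_matrix n v E w $$ (i, j) else 0)"
    by (intro sum.mono_neutral_cong_left) (auto simp: P_def adjacency_matrix_def split: if_splits)
  also have "\<dots> = (\<Sum>i<n. \<Sum>j<n.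
      if v i \<in> X \<and> v j \<notin> X then adjacency_matrix n v E w $$ (i, j) else 0)"
    by (simp add: sum.cartesian_product)
  finally show ?thesis .
qed

text \<open>
  The all-ones vector of the argument is the cut vector of \<open>V\<close> itself.
\<close>

lemma cut_eq_form_diff:
  assumes bij: "bij_betw v {..<n} V" and X: "X \<subseteq> V"
    and N: "N \<in> carrier_mat n n"
    and off_diag: "\<And>i j. i < n \<Longrightarrow> j < n \<Longrightarrow> i \<noteq> j \<Longrightarrow> N $$ (i, j) = adjacency_matrix n v E w $$ (i, j)"
  shows "cut_vector n v V \<bullet> (N *\<^sub>v cut_vector n v V) - cut_vector n v X \<bullet> (N *\<^sub>v cut_vector n v X)
    = 4 * cut V E w X"
proof -
  let ?a = "\<lambda>i j. adjacency_matrix n v E w $$ (i, j)"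
  let ?c = "\<lambda>i j. if v i \<in> X \<and> v j \<notin> X then ?a i j else 0"
  have inV: "v i \<in> V" if "i < n" for i using bij that by (auto simp: bij_betw_def)
  have a_sym: "?a i j = ?a j i" if "i < n" "j < n" for i j
    using that by (simp add: adjacency_matrix_def insert_commute)
  have "cut_vector n v V \<bullet> (N *\<^sub>v cut_vector n v V) - cut_vector n v X \<bullet> (N *\<^sub>v cut_vector n v X)
      = (\<Sum>i<n. \<Sum>j<n. N $$ (i, j) * (cut_vector n v V $ i * cut_vector n v V $ j)
          - N $$ (i, j) * (cut_vector n v X $ i * cut_vector n v X $ j))"
    by (simp add: quadratic_form_sum[OF N] sum_subtractf)
  also have "\<dots> = (\<Sum>i<n. \<Sum>j<n. 2 * ?c i j + 2 * ?c j i)"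
  proof (intro sum.cong refl)
    fix i j assume "i \<in> {..<n}" "j \<in> {..<n}"
    then show "N $$ (i, j) * (cut_vector n v V $ i * cut_vector n v V $ j)
        - N $$ (i, j) * (cut_vector n v X $ i * cut_vector n v X $ j) = 2 * ?c i j + 2 * ?c j i"
      using off_diag[of i j] a_sym[of i j]
      by (cases "i = j") (auto simp: cut_vector_def inV)
  qed
  also have "\<dots> = 2 * (\<Sum>i<n. \<Sum>j<n. ?c i j) + 2 * (\<Sum>i<n. \<Sum>j<n. ?c j i)"
    by (simp only: sum.distrib sum_distrib_left)
  also have "(\<Sum>i<n. \<Sum>j<n. ?c j i) = (\<Sum>i<n. \<Sum>j<n. ?c i j)"
    by (rule sum.swap)
  finally show ?thesis by (simp add: cut_eq_pair_sum[OF bij X])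
qed

theorem corollary2p4:
  fixes V :: "'a set" and E :: "'a set set" and w :: "'a set \<Rightarrow> real"
    and n :: nat and v :: "nat \<Rightarrow> 'a" and N :: "real mat"
  assumes "weighted_graph V E w"
    and "card V = n" and "n > 0"
    and "bij_betw v {..<n} V"
    and "N = adjacency_matrix n v E w \<or> N = signless_laplacian n v E w"
  shows "mcut V E w \<le> real n / 4 * eigenvalue_spread N"
proof -
  have N: "N \<in> carrier_mat n n"
    using assms(5) by (auto simp: adjacency_matrix_def signless_laplacian_def)
  have sym: "transpose_mat N = N"
    using assms(5)
    by (auto simp: adjacency_matrix_def signless_laplacian_def degree_matrix_def insert_commute)
  have off_diag: "N $$ (i, j) = adjacency_matrix n v E w $$ (i, j)"
    if "i < n" "j < n" "i \<noteq> j" for i j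
    using assms(5) that
    by (auto simp: adjacency_matrix_def signless_laplacian_def degree_matrix_def)
  have "cut V E w X \<le> real n / 4 * eigenvalue_spread N" if "X \<subseteq> V" for X
  proof -
    have "4 * cut V E w X \<le> eigenvalue_spread N * real n"
      using form_diff_le_spread[OF N sym assms(3), of "cut_vector n v X" "cut_vector n v V"]
      using cut_eq_form_diff[OF assms(4) that N off_diag]
      by (simp add: cut_vector_norm)
    then show ?thesis by (simp add: field_simps)
  qed
  moreover have "finite V" using assms(1) by (rule weighted_graph.finite_V)
  ultimately show ?thesis
    unfolding mcut_def by (intro Max.boundedI) auto
qed

end
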